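(* Let $m\ge 2$ be an integer, and let $x_1,\dotsc,x_{m-1}$ be odd positive integers such that for all positive integers $i,k$ with $i<k\le m-1$, \[ x_k>\frac{(x_i-2)x_{i}\cdots x_{k-1}}{2\sigma_{k-i-1}(x_i,\dotsc, x_{k-1})-x_i^2\sigma_{k-i-2}(x_{i+1},\dotsc, x_{k-1})}. \] Let $b$ be the smallest odd positive integer greater than \[ \max_{i\in\{1,\dots,m-1\}}\biggl\{\frac{(x_i-2)x_{i}\cdots x_{m-1}}{2\sigma_{m-i-1}(x_i,\dotsc, x_{m-1})-x_i^2\sigma_{m-i-2}(x_{i+1},\dotsc, x_{m-1})}\biggr\}. \] Then the rational numbers whose odd greedy expansion has length $m$ and begins with denominators $x_1,\dotsc,x_{m-1}$ (in this order) are exactly those of the form \[ \frac{\sigma_{m-1}(x_1,\dotsc ,x_{m-1},b)+2\sigma_{m-2}(x_1,\dotsc ,x_{m-1})t}{x_1\cdots x_{m-1}b+2x_1\cdots x_{m-1}t}, \] where $t$ is any nonnegative integer.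
   Context: For variables $y_1,\dots,y_r$ ($r\ge 0$) and an integer $k$, $\sigma_k(y_1,\dots,y_r)=\sum_{I\subseteq\{1,\dots,r\},|I|=k}\prod_{i\in I}y_i$ is the elementary symmetric polynomial; $\sigma_0=1$ (also for an empty list of variables), $\sigma_k=0$ for $k<0$ and for $k>r$. Odd greedy expansion: given a positive rational $q$, define $x_1,x_2,\dots$ recursively: writing $R_i=q-\sum_{j=1}^{i-1}1/x_j$, if $R_i\ge1$ let $x_i=1$, and if $0<R_i<1$ let $x_i$ be the unique odd positive integer with $\frac1{x_i}\le R_i<\frac1{x_i-2}$; stop when the remainder is $0$. The $x_i$ are the denominators, and the number of terms is the length. *)

theory Defs imports Complex_Main begin

(* For k < 0 and for k > length ys there is no index set I, so the sum is 0. *)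
definition sigma :: "int \<Rightarrow> 'a::comm_semiring_1 list \<Rightarrow> 'a" where
  "sigma k ys = (\<Sum>I | I \<subseteq> {..<length ys} \<and> int (card I) = k. \<Prod>i\<in>I. ys ! i)"

lemma sigma_neg: "k < 0 \<Longrightarrow> sigma k ys = 0"
  by (auto simp: sigma_def intro!: sum.neutral)

lemma sigma_0: "sigma 0 ys = 1"
proof -
  have "{I. I \<subseteq> {..<length ys} \<and> int (card I) = 0} = {{}}"
    by (auto simp: card_eq_0_iff dest: finite_subset[OF _ finite_lessThan])
  then show ?thesis by (simp add: sigma_def)
qed

lemma sigma_beyond: "k > int (length ys) \<Longrightarrow> sigma k ys = 0"
proof -
  assume k: "k > int (length ys)"
  have "int (card I) \<noteq> k" if "I \<subseteq> {..<length ys}" for I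
  proof -
    have "card I \<le> length ys" using card_mono[OF finite_lessThan that] by simp
    with k show ?thesis by linarith
  qed
  then have "{I. I \<subseteq> {..<length ys} \<and> int (card I) = k} = {}" by blast
  then show ?thesis by (simp only: sigma_def sum.empty)
qed

(* Only meaningful for R > 0. *)
definition odd_greedy_step :: "rat \<Rightarrow> int" where
  "odd_greedy_step R = (if R \<ge> 1 then 1
     else (THE x. odd x \<and> 0 < x \<and> 1 / of_int x \<le> R \<and> R < 1 / of_int (x - 2)))"

lemma odd_greedy_step_ex1:
  fixes R :: rat
  assumes "0 < R" "R < 1"
  shows "\<exists>!x::int. odd x \<and> 0 < x \<and> 1 / of_int x \<le> R \<and> R < 1 / of_int (x - 2)"
proof -
  have char: "(odd x \<and> 0 < x \<and> 1 / of_int x \<le> R \<and> R < 1 / of_int (x - 2))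
      \<longleftrightarrow> (odd x \<and> x \<ge> 3 \<and> 1 / R \<le> of_int x \<and> of_int x < 1 / R + 2)" for x :: int
  proof (cases "x \<ge> 3")
    case True
    then have "(of_int x :: rat) > 0" "(of_int (x - 2) :: rat) > 0" by linarith+
    then have "1 / of_int x \<le> R \<longleftrightarrow> 1 / R \<le> of_int x"
      "R < 1 / of_int (x - 2) \<longleftrightarrow> of_int x < 1 / R + 2"
      using assms(1) by (simp_all add: field_simps)
    with True show ?thesis by auto
  next
    case False
    have "\<not> (odd x \<and> 0 < x \<and> 1 / of_int x \<le> R \<and> R < 1 / of_int (x - 2))"
    proof
      assume a: "odd x \<and> 0 < x \<and> 1 / of_int x \<le> R \<and> R < 1 / of_int (x - 2)"
      with False have "x = 1 \<or> x = 2" by linarith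
      with a have "x = 1" by auto
      with a assms show False by simp
    qed
    with False show ?thesis by auto
  qed
  define y where "y = 1 / R"
  define c where "c = (if odd \<lceil>y\<rceil> then \<lceil>y\<rceil> else \<lceil>y\<rceil> + 1)"
  have y: "y > 1" using assms by (simp add: y_def field_simps)
  have c1: "odd c" by (simp add: c_def)
  have c2: "y \<le> of_int c" "of_int c < y + 2" unfolding c_def by (cases "odd \<lceil>y\<rceil>"; simp; linarith)+
  have "c > 1" using c2(1) y by linarith
  with c1 have c3: "c \<ge> 3" by presburger
  show ?thesis
    unfolding char y_def[symmetric]
  proof (rule ex1I[of _ c])
    show "odd c \<and> 3 \<le> c \<and> y \<le> of_int c \<and> of_int c < y + 2" using c1 c2 c3 by blast
    fix x :: int assume x: "odd x \<and> 3 \<le> x \<and> y \<le> of_int x \<and> of_int x < y + 2"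
    then have "(of_int x :: rat) < of_int (c + 2)" "(of_int c :: rat) < of_int (x + 2)"
      using c2 by simp_all
    then have "x < c + 2" "c < x + 2" unfolding of_int_less_iff by auto
    moreover have "odd x" using x by blast
    ultimately show "x = c" using c1 by presburger
  qed
qed

(* Indices start at 1; the values past the first zero remainder are irrelevant. *)
function odd_greedy_denom :: "rat \<Rightarrow> nat \<Rightarrow> int" where
  "odd_greedy_denom q i =
     odd_greedy_step (q - (\<Sum>j\<in>{1..<i}. 1 / of_int (odd_greedy_denom q j)))"
  by pat_completeness auto
termination by (relation "measure snd") auto

declare odd_greedy_denom.simps [simp del]

definition odd_greedy_remainder :: "rat \<Rightarrow> nat \<Rightarrow> rat" where
  "odd_greedy_remainder q i = q - (\<Sum>j\<in>{1..<i}. 1 / of_int (odd_greedy_denom q j))"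

definition odd_greedy_has_length :: "rat \<Rightarrow> nat \<Rightarrow> bool" where
  "odd_greedy_has_length q m \<longleftrightarrow>
     (\<forall>i\<in>{1..m}. odd_greedy_remainder q i > 0) \<and> odd_greedy_remainder q (m + 1) = 0"

definition odd_greedy_bound :: "(nat \<Rightarrow> int) \<Rightarrow> nat \<Rightarrow> nat \<Rightarrow> rat" where
  "odd_greedy_bound x i k =
     of_int ((x i - 2) * (\<Prod>j\<in>{i..<k}. x j)) /
     of_int (2 * sigma (int k - int i - 1) (map x [i..<k])
             - (x i)\<^sup>2 * sigma (int k - int i - 2) (map x [i + 1..<k]))"

end

theory Submission imports Defs begin

text \<open>
  Write $S(i,k) = \sum_{i \le j < k} 1/x_j$. Dividing by $x_i \cdots x_{k-1}$, the bound for
  $(i,k)$ with $x_i \ge 3$ is the reciprocal of the gap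
  $1/(x_i-2) - S(i,k)$. If the gap for $(i,k)$ is positive, then $x_k$ exceeds the bound exactly
  when the gap for $(i,k+1)$ is positive as well; the gap for $(i,i+1)$ always is. Hence the hypotheses
  make all gaps up to $k = m$ positive, and for an odd $c > 0$ the greedy choice on $S(1,m) + 1/c$
  picks $x_1,\dots,x_{m-1}$, and then necessarily $c$, exactly when $c$ exceeds all bounds for $(i,m)$.
\<close>

section \<open>Elementary symmetric polynomials in degrees near the top\<close>

lemma sigma_snoc: "sigma k (ys @ [b]) = sigma k ys + b * sigma (k - 1) ys"
proof -
  let ?n = "length ys"
  let ?f = "\<lambda>I. \<Prod>i\<in>I. (ys @ [b]) ! i"
  let ?A = "{I. I \<subseteq> {..<?n} \<and> int (card I) = k}"
  let ?B = "{I. I \<subseteq> {..<?n} \<and> int (card I) = k - 1}"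
  have fin: "finite ?A" "finite ?B"
    by (auto intro: finite_subset[of _ "Pow {..<?n}"])
  have card_ins: "card (insert ?n I) = Suc (card I)" if "I \<subseteq> {..<?n}" for I
    using that finite_subset[OF that] by (subst card_insert_disjoint) auto
  \<comment> \<open>Index sets are sorted by whether they contain the last index \<open>?n\<close>;
    those that do arise from the sets in \<open>?B\<close> by inserting it. No case distinction on
    the integer \<open>k\<close> arises.\<close>
  have split: "{I. I \<subseteq> {..<length (ys @ [b])} \<and> int (card I) = k} = ?A \<union> insert ?n ` ?B"
    (is "?L = _")
  proof (intro equalityI subsetI)
    fix I assume I: "I \<in> ?L"
    show "I \<in> ?A \<union> insert ?n ` ?B"
    proof (cases "?n \<in> I")
      case True
      have sub: "I - {?n} \<subseteq> {..<?n}" using I by (auto simp: less_Suc_eq)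
      have eq: "I = insert ?n (I - {?n})" using True by auto
      have "int (card (I - {?n})) = k - 1"
        using card_ins[OF sub] I eq by auto
      then show ?thesis using sub eq by blast
    next
      case False
      then have "I \<subseteq> {..<?n}" using I by (force simp: less_Suc_eq)
      then show ?thesis using I by auto
    qed
  next
    fix I assume "I \<in> ?A \<union> insert ?n ` ?B"
    then show "I \<in> ?L" by (auto simp: card_ins)
  qed
  have inj: "inj_on (insert ?n) ?B"
    by (rule inj_onI) (metis (no_types, lifting) insert_ident lessThan_iff less_irrefl
        mem_Collect_eq subsetD)
  have "sigma k (ys @ [b]) = sum ?f ?A + sum ?f (insert ?n ` ?B)"
    unfolding sigma_def split using fin by (intro sum.union_disjoint) auto
  also have "sum ?f ?A = sigma k ys"
    unfolding sigma_def by (intro sum.cong prod.cong) (auto simp: nth_append)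
  also have "sum ?f (insert ?n ` ?B) = (\<Sum>I\<in>?B. ?f (insert ?n I))"
    using inj by (simp add: sum.reindex)
  also have "\<dots> = (\<Sum>I\<in>?B. b * (\<Prod>i\<in>I. ys ! i))"
  proof (rule sum.cong)
    fix I assume "I \<in> ?B"
    then have I: "I \<subseteq> {..<?n}" "finite I" "?n \<notin> I" by (auto intro: finite_subset)
    have "?f (insert ?n I) = b * ?f I" using I by simp
    also have "?f I = (\<Prod>i\<in>I. ys ! i)" using I(1) by (intro prod.cong) (auto simp: nth_append)
    finally show "?f (insert ?n I) = b * (\<Prod>i\<in>I. ys ! i)" .
  qed simp
  also have "\<dots> = b * sigma (k - 1) ys"
    unfolding sigma_def by (simp add: sum_distrib_left)
  finally show ?thesis .
qed

lemma sigma_length_upt: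
  assumes "i \<le> k"
  shows "sigma (int k - int i) (map x [i..<k]) = (\<Prod>j\<in>{i..<k}. x j)"
  using assms
proof (induction k rule: dec_induct)
  case base
  then show ?case by (simp add: sigma_0)
next
  case (step k)
  \<comment> \<open>The degree exceeds the length of the shorter list by one, so in
    \<open>sigma_snoc\<close> only the summand with factor \<open>x k\<close> survives.\<close>
  then have "sigma (int (Suc k) - int i) (map x [i..<k]) = 0" by (intro sigma_beyond) auto
  moreover have "int (Suc k) - int i - 1 = int k - int i" by simp
  ultimately show ?case using step by (simp add: sigma_snoc mult.commute)
qed

text \<open>An index set with one index missing contributes the full product divided by the missing
  entry. This turns the bound and the fractions of the theorem into sums of reciprocals.\<close>

lemma of_int_sigma_upt_eq_prod_sum:
  fixes x :: "nat \<Rightarrow> int"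
  assumes "i \<le> k" "\<And>j. i \<le> j \<Longrightarrow> j < k \<Longrightarrow> x j \<noteq> 0"
  shows "(of_int (sigma (int k - int i - 1) (map x [i..<k])) :: rat) =
    of_int (\<Prod>j\<in>{i..<k}. x j) * (\<Sum>j\<in>{i..<k}. 1 / of_int (x j))"
  using assms
proof (induction k rule: dec_induct)
  \<comment> \<open>The degree is -1 here, where \<open>sigma\<close> vanishes just as the empty sum
    on the right does.\<close>
  case base
  then show ?case by (simp add: sigma_neg)
next
  case (step k)
  have *: "int (Suc k) - int i - 1 = int k - int i" by simp
  have "x k \<noteq> 0" using step by auto
  then show ?case unfolding *
    using step by (simp add: sigma_snoc sigma_length_upt field_simps)
qed

section \<open>The bound as the reciprocal of a gap\<close>

lemma odd_greedy_bound_eq: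
  assumes "i < k" and pos: "\<And>j. i \<le> j \<Longrightarrow> j < k \<Longrightarrow> x j > 0"
  shows "odd_greedy_bound x i k =
    of_int (x i - 2) / (2 / of_int (x i) - of_int (x i - 2) * (\<Sum>j\<in>{Suc i..<k}. 1 / of_int (x j)))"
proof -
  define P where "P = (of_int (\<Prod>j\<in>{Suc i..<k}. x j) :: rat)"
  define S where "S = (\<Sum>j\<in>{Suc i..<k}. 1 / of_int (x j) :: rat)"
  define a where "a = (of_int (x i) :: rat)"
  have a: "a > 0" using assms by (simp add: a_def)
  have "(\<Prod>j\<in>{Suc i..<k}. x j) > 0" using pos by (intro prod_pos) auto
  then have P: "P > 0" unfolding P_def by (simp only: of_int_0_less_iff)
  have P': "of_int (\<Prod>j\<in>{i..<k}. x j) = a * P"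
    using assms by (simp add: a_def P_def prod.atLeast_Suc_lessThan)
  have nz: "\<And>j. i \<le> j \<Longrightarrow> j < k \<Longrightarrow> x j \<noteq> 0" using pos by force
  have s1: "of_int (sigma (int k - int i - 1) (map x [i..<k])) = a * P * (1 / a + S)"
    using of_int_sigma_upt_eq_prod_sum[OF less_imp_le[OF \<open>i < k\<close>] nz] P' \<open>i < k\<close>
    by (simp add: sum.atLeast_Suc_lessThan S_def a_def)
  \<comment> \<open>Without its first entry the list is shorter by one, so this degree is again one
    below the length.\<close>
  have "int k - int i - 2 = int k - int (Suc i) - 1" by simp
  then have s2: "of_int (sigma (int k - int i - 2) (map x [i + 1..<k])) = P * S"
    using of_int_sigma_upt_eq_prod_sum[of "Suc i" k x] nz \<open>i < k\<close>
    by (simp add: S_def P_def)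
  have "odd_greedy_bound x i k = (a - 2) * (a * P) / (2 * (a * P * (1 / a + S)) - a\<^sup>2 * (P * S))"
    unfolding odd_greedy_bound_def of_int_diff of_int_mult P' of_int_power s1 s2 a_def by simp
  \<comment> \<open>The positive factor \<open>a * P\<close> is split off to be cancelled; nothing
    is assumed about the sign of the denominator that remains.\<close>
  also have "2 * (a * P * (1 / a + S)) - a\<^sup>2 * (P * S) = (2 / a - (a - 2) * S) * (a * P)"
    using a by (simp add: field_simps power2_eq_square)
  also have "(a - 2) * (a * P) / ((2 / a - (a - 2) * S) * (a * P)) = (a - 2) / (2 / a - (a - 2) * S)"
    using a P by simp
  finally show ?thesis by (simp add: a_def S_def)
qed

text \<open>For the gap \<open>g\<close> the denominator factors as \<open>(a - 2) * g\<close>, so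
  the bound is \<open>1 / g\<close>, and taking reciprocals turns \<open>1 / g < c\<close> into
  \<open>1 / c < g\<close>. The reversal relies on \<open>g > 0\<close>: a negative gap gives a
  negative bound, which every positive \<open>c\<close> exceeds.\<close>

lemma odd_greedy_bound_less_iff:
  assumes "i < k" and pos: "\<And>j. i \<le> j \<Longrightarrow> j < k \<Longrightarrow> x j > 0"
    and xi: "x i \<ge> 3" and gap: "(\<Sum>j\<in>{i..<k}. 1 / of_int (x j)) < 1 / (of_int (x i - 2) :: rat)"
    and "c > 0"
  shows "odd_greedy_bound x i k < of_int c \<longleftrightarrow>
    (\<Sum>j\<in>{i..<k}. 1 / of_int (x j)) + 1 / of_int c < 1 / (of_int (x i - 2) :: rat)"
proof -
  define S where "S = (\<Sum>j\<in>{Suc i..<k}. 1 / of_int (x j) :: rat)"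
  define a where "a = (of_int (x i) :: rat)"
  define g where "g = 1 / (a - 2) - 1 / a - S"
  define d where "d = (of_int c :: rat)"
  have a: "a \<ge> 3" using xi unfolding a_def by linarith
  have d: "d > 0" using \<open>c > 0\<close> by (simp add: d_def)
  have sum: "(\<Sum>j\<in>{i..<k}. 1 / of_int (x j)) = 1 / a + S"
    using \<open>i < k\<close> by (simp add: sum.atLeast_Suc_lessThan S_def a_def)
  have g: "g > 0" using gap unfolding sum g_def by (simp add: a_def)
  have "2 / a - (a - 2) * S = (a - 2) * g"
    using a by (simp add: g_def field_simps)
  then have "odd_greedy_bound x i k = (a - 2) / ((a - 2) * g)"
    by (simp add: odd_greedy_bound_eq[OF assms(1,2)] a_def S_def)
  also have "\<dots> = 1 / g" using a by simp
  also have "1 / g < d \<longleftrightarrow> 1 / d < g"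
    using g d by (simp add: field_simps)
  finally have "odd_greedy_bound x i k < d \<longleftrightarrow> 1 / d < g" .
  then show ?thesis unfolding sum by (auto simp: g_def a_def d_def)
qed

text \<open>For \<open>x i = 1\<close> the bound is -1 divided by 2 plus a nonnegative sum. It thus
  excludes no positive denominator, in accordance with the greedy choice 1, which puts no upper
  limit on the remainder.\<close>

lemma odd_greedy_bound_neg:
  assumes "i < k" "\<And>j. i \<le> j \<Longrightarrow> j < k \<Longrightarrow> x j > 0" "x i = 1"
  shows "odd_greedy_bound x i k < 0"
proof -
  have "(\<Sum>j\<in>{Suc i..<k}. 1 / of_int (x j) :: rat) \<ge> 0"
    using assms by (intro sum_nonneg) (auto intro: less_imp_le)
  then show ?thesis
    by (simp add: odd_greedy_bound_eq[OF assms(1,2)] assms(3) divide_less_0_iff)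
qed

text \<open>Supplies the hypothesis \<open>gap\<close> of \<open>odd_greedy_bound_less_iff\<close>;
  that equivalence, with \<open>x k\<close> as the new denominator, is itself the induction
  step.\<close>

lemma sum_inverse_less_of_bounds:
  assumes "i < k" and pos: "\<And>j. i \<le> j \<Longrightarrow> j < k \<Longrightarrow> x j > 0"
    and xi: "x i \<ge> 3" and bounds: "\<And>l. i < l \<Longrightarrow> l < k \<Longrightarrow> odd_greedy_bound x i l < of_int (x l)"
  shows "(\<Sum>j\<in>{i..<k}. 1 / of_int (x j)) < 1 / (of_int (x i - 2) :: rat)"
proof -
  have "Suc i \<le> k" using \<open>i < k\<close> by simp
  then show ?thesis using pos bounds
  proof (induction k rule: dec_induct)
    case base
    have "(of_int (x i) :: rat) \<ge> 3" using xi by linarith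
    then show ?case by (simp add: field_simps)
  next
    case (step k)
    then have "odd_greedy_bound x i k < of_int (x k)" by simp
    moreover have "(\<Sum>j\<in>{i..<k}. 1 / of_int (x j)) < 1 / (of_int (x i - 2) :: rat)"
      using step by simp
    ultimately show ?case
      using odd_greedy_bound_less_iff[of i k x "x k"] step xi by simp
  qed
qed

section \<open>Greedy steps, remainders and expansions\<close>

lemma odd_greedy_step_props:
  assumes "R > 0"
  shows "odd (odd_greedy_step R)" "odd_greedy_step R > 0"
    and "1 / of_int (odd_greedy_step R) \<le> R"
    and "odd_greedy_step R \<ge> 3 \<Longrightarrow> R < 1 / of_int (odd_greedy_step R - 2)"
proof -
  have "odd (odd_greedy_step R) \<and> odd_greedy_step R > 0 \<and> 1 / of_int (odd_greedy_step R) \<le> R \<and>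
    (odd_greedy_step R \<ge> 3 \<longrightarrow> R < 1 / of_int (odd_greedy_step R - 2))"
  proof (cases "R \<ge> 1")
    case True
    then show ?thesis by (simp add: odd_greedy_step_def)
  next
    case False
    then show ?thesis
      using theI'[OF odd_greedy_step_ex1[of R]] assms by (simp add: odd_greedy_step_def)
  qed
  then show "odd (odd_greedy_step R)" "odd_greedy_step R > 0"
    and "1 / of_int (odd_greedy_step R) \<le> R"
    and "odd_greedy_step R \<ge> 3 \<Longrightarrow> R < 1 / of_int (odd_greedy_step R - 2)"
    by blast+
qed

text \<open>Covers both branches of \<open>odd_greedy_step\<close> at once: for \<open>c = 1\<close>
  the lower inequality already says \<open>R >= 1\<close>, so an upper one is demanded only from
  \<open>c = 3\<close> on.\<close>

lemma odd_greedy_step_eqI: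
  assumes "odd c" "c > 0" "1 / of_int c \<le> R" "c \<ge> 3 \<Longrightarrow> R < 1 / of_int (c - 2)"
  shows "odd_greedy_step R = c"
proof (cases "c \<ge> 3")
  case True
  have R: "0 < R" "R < 1"
  proof -
    have "(of_int c :: rat) \<ge> 3" using True by linarith
    then have "1 / of_int (c - 2) \<le> (1 :: rat)" "0 < 1 / (of_int c :: rat)" by simp_all
    then show "0 < R" "R < 1" using assms True by linarith+
  qed
  then show ?thesis
    using the1_equality[OF odd_greedy_step_ex1[OF R], of c] assms True
    by (simp add: odd_greedy_step_def)
next
  case False
  then have "c = 1" using assms(1,2) by presburger
  then show ?thesis using assms by (simp add: odd_greedy_step_def)
qed

lemma odd_greedy_denom_eq_step: "odd_greedy_denom q i = odd_greedy_step (odd_greedy_remainder q i)"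
  by (subst odd_greedy_denom.simps) (simp add: odd_greedy_remainder_def)

lemma odd_greedy_remainder_eq:
  assumes "\<And>j. 1 \<le> j \<Longrightarrow> j < i \<Longrightarrow> odd_greedy_denom q j = x j"
  shows "odd_greedy_remainder q i = q - (\<Sum>j\<in>{1..<i}. 1 / of_int (x j))"
  unfolding odd_greedy_remainder_def using assms by (intro arg_cong2[of _ _ _ _ minus] sum.cong) auto

lemma odd_greedy_remainder_Suc:
  "1 \<le> i \<Longrightarrow> odd_greedy_remainder q (Suc i) =
     odd_greedy_remainder q i - 1 / of_int (odd_greedy_denom q i)"
  by (simp add: odd_greedy_remainder_def)

text \<open>The i-th remainder is the tail of the x-sum from i on, plus \<open>1 / c\<close>. Its
  lower greedy inequality is automatic, since for i < m the tail starts with \<open>1 / x i\<close>;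
  the upper one is equivalent to the bound at (i, m).\<close>

lemma odd_greedy_expansion_iff:
  assumes m: "m \<ge> 1" and odd_pos: "\<And>i. 1 \<le> i \<Longrightarrow> i < m \<Longrightarrow> odd (x i) \<and> x i > 0"
    and bounds: "\<And>i k. 1 \<le> i \<Longrightarrow> i < k \<Longrightarrow> k < m \<Longrightarrow> odd_greedy_bound x i k < of_int (x k)"
  shows "odd_greedy_has_length q m \<and> (\<forall>i\<in>{1..<m}. odd_greedy_denom q i = x i) \<longleftrightarrow>
    (\<exists>c. odd c \<and> c > 0 \<and> (\<forall>i\<in>{1..<m}. odd_greedy_bound x i m < of_int c) \<and>
      q = (\<Sum>j\<in>{1..<m}. 1 / of_int (x j)) + 1 / of_int c)"
    (is "?L \<longleftrightarrow> ?R")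
proof -
  \<comment> \<open>The guard \<open>x i >= 3\<close> absorbs the case \<open>x i = 1\<close>, where
    both sides hold trivially.\<close>
  have bound_iff: "odd_greedy_bound x i m < of_int c \<longleftrightarrow>
      (x i \<ge> 3 \<longrightarrow> (\<Sum>j\<in>{i..<m}. 1 / of_int (x j)) + 1 / of_int c < 1 / (of_int (x i - 2) :: rat))"
    if "1 \<le> i" "i < m" "c > 0" for i c
  proof (cases "x i \<ge> 3")
    case True
    have pos: "\<And>j. i \<le> j \<Longrightarrow> j < m \<Longrightarrow> x j > 0" using odd_pos that by auto
    have "(\<Sum>j\<in>{i..<m}. 1 / of_int (x j)) < 1 / (of_int (x i - 2) :: rat)"
      using sum_inverse_less_of_bounds[of i m x] pos that True bounds by auto
    then show ?thesis using odd_greedy_bound_less_iff[of i m x c] pos that True by simp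
  next
    case False
    then have "x i = 1" using odd_pos[of i] that by presburger
    then have "odd_greedy_bound x i m < 0" using odd_greedy_bound_neg[of i m x] odd_pos that by auto
    also have "0 < (of_int c :: rat)" using that by simp
    finally show ?thesis using False by simp
  qed
  have split: "(\<Sum>j\<in>{1..<m}. 1 / of_int (x j) :: rat) =
      (\<Sum>j\<in>{1..<i}. 1 / of_int (x j)) + (\<Sum>j\<in>{i..<m}. 1 / of_int (x j))"
    if "1 \<le> i" "i \<le> m" for i
    using that by (simp add: sum.atLeastLessThan_concat)
  show ?thesis
  proof
    assume L: ?L
    define c where "c = odd_greedy_denom q m"
    have rem_pos: "odd_greedy_remainder q i > 0" if "1 \<le> i" "i \<le> m" for i
      using L that by (auto simp: odd_greedy_has_length_def)
    have rem: "odd_greedy_remainder q i = q - (\<Sum>j\<in>{1..<i}. 1 / of_int (x j))" if "i \<le> m" for i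
      using L that by (intro odd_greedy_remainder_eq) auto
    have c: "odd c" "c > 0"
      unfolding c_def odd_greedy_denom_eq_step
      using odd_greedy_step_props[OF rem_pos[of m]] m by auto
    have "odd_greedy_remainder q (Suc m) = 0"
      using L by (simp add: odd_greedy_has_length_def)
    then have q: "q = (\<Sum>j\<in>{1..<m}. 1 / of_int (x j)) + 1 / of_int c"
      using m rem[of m] by (simp add: odd_greedy_remainder_Suc c_def)
    have "odd_greedy_bound x i m < of_int c" if i: "1 \<le> i" "i < m" for i
    proof (subst bound_iff[OF i c(2)], intro impI)
      assume "x i \<ge> 3"
      moreover have "x i = odd_greedy_step (odd_greedy_remainder q i)"
        using L i by (simp flip: odd_greedy_denom_eq_step)
      ultimately have "odd_greedy_remainder q i < 1 / of_int (x i - 2)"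
        using odd_greedy_step_props(4)[OF rem_pos[of i]] i by simp
      then show "(\<Sum>j\<in>{i..<m}. 1 / of_int (x j)) + 1 / of_int c < 1 / (of_int (x i - 2) :: rat)"
        using rem[of i] q split[of i] i by simp
    qed
    then show ?R using c q by auto
  next
    assume ?R
    then obtain c where c: "odd c" "c > 0"
      and cb: "\<And>i. 1 \<le> i \<Longrightarrow> i < m \<Longrightarrow> odd_greedy_bound x i m < of_int c"
      and q: "q = (\<Sum>j\<in>{1..<m}. 1 / of_int (x j)) + 1 / of_int c"
      by auto
    have tail: "q - (\<Sum>j\<in>{1..<i}. 1 / of_int (x j)) = (\<Sum>j\<in>{i..<m}. 1 / of_int (x j)) + 1 / of_int c"
      if "1 \<le> i" "i \<le> m" for i
      using split[OF that] q by simp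
    have nonneg: "(\<Sum>j\<in>{i..<m}. 1 / of_int (x j) :: rat) \<ge> 0" if "1 \<le> i" for i
      using odd_pos that by (intro sum_nonneg) (auto intro: less_imp_le)
    have cpos: "1 / (of_int c :: rat) > 0" using c by simp
    have denom: "odd_greedy_denom q i = x i" if "1 \<le> i" "i < m" for i
      using that
    \<comment> \<open>Strong induction, because the i-th remainder depends on all earlier
      denominators.\<close>
    proof (induction i rule: less_induct)
      case (less i)
      have rem: "odd_greedy_remainder q i = (\<Sum>j\<in>{i..<m}. 1 / of_int (x j)) + 1 / of_int c"
        using odd_greedy_remainder_eq[of i q x] less tail[of i] by auto
      show ?case unfolding odd_greedy_denom_eq_step
      proof (rule odd_greedy_step_eqI)
        show "odd (x i)" "0 < x i" using odd_pos less by auto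
        have "(\<Sum>j\<in>{i..<m}. 1 / of_int (x j) :: rat) =
            1 / of_int (x i) + (\<Sum>j\<in>{Suc i..<m}. 1 / of_int (x j))"
          using less by (simp add: sum.atLeast_Suc_lessThan)
        then show "1 / of_int (x i) \<le> odd_greedy_remainder q i"
          using rem nonneg[of "Suc i"] cpos by simp
        show "odd_greedy_remainder q i < 1 / of_int (x i - 2)" if "x i \<ge> 3"
          unfolding rem using bound_iff[of i c] cb[of i] less c that by simp
      qed
    qed
    have rem: "odd_greedy_remainder q i = (\<Sum>j\<in>{i..<m}. 1 / of_int (x j)) + 1 / of_int c"
      if "1 \<le> i" "i \<le> m" for i
      using odd_greedy_remainder_eq[of i q x] denom that tail[of i] by auto
    \<comment> \<open>The remainder is now exactly \<open>1 / c\<close>, which lies below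
      \<open>1 / (c - 2)\<close> whenever \<open>c >= 3\<close>, so the last choice is forced
      without any bound.\<close>
    have "odd_greedy_denom q m = c"
      unfolding odd_greedy_denom_eq_step
    proof (rule odd_greedy_step_eqI)
      show "odd_greedy_remainder q m < 1 / of_int (c - 2)" if "c \<ge> 3"
      proof -
        have "(of_int c :: rat) \<ge> 3" using that by linarith
        then have "1 / (of_int c :: rat) < 1 / of_int (c - 2)" by (simp add: field_simps)
        then show ?thesis using rem[of m] m by simp
      qed
    qed (use c m rem[of m] in auto)
    then have "odd_greedy_remainder q (m + 1) = 0"
      using m rem[of m] by (simp add: odd_greedy_remainder_Suc)
    moreover have "odd_greedy_remainder q i > 0" if "1 \<le> i" "i \<le> m" for i
      using rem[OF that] nonneg[of i] cpos that by linarith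
    ultimately show ?L using denom by (auto simp: odd_greedy_has_length_def)
  qed
qed

section \<open>Parametrising the last denominator, and the theorem\<close>

lemma odd_greater_iff_Least_odd:
  fixes y :: rat and b c :: int
  assumes b: "b = (LEAST c. odd c \<and> c > 0 \<and> of_int c > y)"
  shows "odd c \<and> c > 0 \<and> of_int c > y \<longleftrightarrow> (\<exists>t::nat. c = b + 2 * int t)"
proof -
  let ?Q = "\<lambda>c. odd c \<and> c > 0 \<and> of_int c > y"
  have ex: "\<exists>n. ?Q (int n)"
  proof -
    obtain n where n: "y < of_nat n" using reals_Archimedean2 by blast
    have "y < of_int (int (2 * n + 1))" using n by simp
    then show ?thesis by (intro exI[of _ "2 * n + 1"]) simp
  qed
  \<comment> \<open>\<open>LEAST\<close> over the integers need not be attained, so the minimum is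
    taken over the naturals and then identified with \<open>b\<close>; this works because
    \<open>?Q\<close> forces positivity.\<close>
  define n where "n = (LEAST n. ?Q (int n))"
  have Qn: "?Q (int n)" unfolding n_def using ex by (rule LeastI_ex)
  have le: "int n \<le> c" if "?Q c" for c
  proof -
    have "?Q (int (nat c))" using that by simp
    then have "n \<le> nat c" unfolding n_def by (rule Least_le)
    then show ?thesis using that by linarith
  qed
  have bn: "b = int n" unfolding b by (rule Least_equality) (use Qn le in auto)
  show ?thesis
  proof
    assume c: "?Q c"
    have "b \<le> c" "even (c - b)" using le[OF c] c Qn bn by simp_all
    then obtain s where "c - b = 2 * s" "s \<ge> 0" by (metis dvdE diff_ge_0_iff_ge
          zero_le_mult_iff not_numeral_le_zero)
    then have "c = b + 2 * int (nat s)" by simp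
    then show "\<exists>t::nat. c = b + 2 * int t" by blast
  next
    assume "\<exists>t::nat. c = b + 2 * int t"
    then obtain t :: nat where t: "c = b + 2 * int t" by blast
    have "(of_int b :: rat) \<le> of_int c" unfolding of_int_le_iff t by simp
    then show "?Q c" using Qn bn t by auto
  qed
qed

text \<open>Both \<open>b\<close> and \<open>t\<close> enter only through
  \<open>c = b + 2 * t\<close>: by \<open>sigma_snoc\<close> the numerator is
  \<open>P + c * s\<close> and the denominator \<open>P * c\<close>, and \<open>s / P\<close> is the
  sum of reciprocals.\<close>

lemma sigma_fraction_eq:
  fixes x :: "nat \<Rightarrow> int" and b t :: int
  assumes "m \<ge> 1" "\<And>j. 1 \<le> j \<Longrightarrow> j < m \<Longrightarrow> x j > 0" "b + 2 * t \<noteq> 0"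
  shows "of_int (sigma (int m - 1) (map x [1..<m] @ [b]) + 2 * sigma (int m - 2) (map x [1..<m]) * t) /
    of_int ((\<Prod>j\<in>{1..<m}. x j) * b + 2 * (\<Prod>j\<in>{1..<m}. x j) * t) =
    (\<Sum>j\<in>{1..<m}. 1 / of_int (x j)) + 1 / (of_int (b + 2 * t) :: rat)"
proof -
  define P where "P = (\<Prod>j\<in>{1..<m}. x j)"
  define s where "s = sigma (int m - 2) (map x [1..<m])"
  define S where "S = (\<Sum>j\<in>{1..<m}. 1 / of_int (x j) :: rat)"
  define c where "c = b + 2 * t"
  have "P > 0" unfolding P_def using assms by (intro prod_pos) auto
  then have P: "(of_int P :: rat) \<noteq> 0" by simp
  have c: "(of_int c :: rat) \<noteq> 0" using assms(3) unfolding c_def of_int_eq_0_iff by simp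
  have s: "of_int s = of_int P * S"
    using of_int_sigma_upt_eq_prod_sum[of 1 m x] assms unfolding s_def P_def S_def by force
  have "sigma (int m - 1) (map x [1..<m] @ [b]) = P + b * s"
    using sigma_length_upt[of 1 m x] assms(1) by (simp add: sigma_snoc P_def s_def)
  then have num: "sigma (int m - 1) (map x [1..<m] @ [b]) + 2 * s * t = P + c * s"
    by (simp add: c_def algebra_simps)
  have den: "P * b + 2 * P * t = P * c" by (simp add: c_def algebra_simps)
  have "(of_int (P + c * s) :: rat) / of_int (P * c) = S + 1 / of_int c"
    using P c by (simp add: s field_simps)
  then show ?thesis
    unfolding P_def[symmetric] s_def[symmetric] S_def[symmetric] num den c_def[symmetric] .
qed

theorem theorem3p2:
  fixes m :: nat and x :: "nat \<Rightarrow> int" and b :: int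
  assumes "m \<ge> 2"
    and "\<forall>i\<in>{1..m - 1}. odd (x i) \<and> x i > 0"
    and "\<forall>i k. 1 \<le> i \<and> i < k \<and> k \<le> m - 1 \<longrightarrow> of_int (x k) > odd_greedy_bound x i k"
    and "b = (LEAST c. odd c \<and> c > 0 \<and>
                of_int c > Max ((\<lambda>i. odd_greedy_bound x i m) ` {1..m - 1}))"
  shows "{q :: rat. q > 0 \<and> odd_greedy_has_length q m \<and>
            (\<forall>i\<in>{1..m - 1}. odd_greedy_denom q i = x i)} =
         {of_int (sigma (int m - 1) (map x [1..<m] @ [b])
                  + 2 * sigma (int m - 2) (map x [1..<m]) * int t) /
          of_int ((\<Prod>j\<in>{1..m - 1}. x j) * b + 2 * (\<Prod>j\<in>{1..m - 1}. x j) * int t)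
          | t :: nat. True}"
proof -
  have ivl: "{1..m - 1} = {1..<m}" using assms(1) by auto
  have odd_pos: "odd (x i) \<and> x i > 0" if "1 \<le> i" "i < m" for i
    using assms(2) that unfolding ivl by simp
  have bounds: "odd_greedy_bound x i k < of_int (x k)" if "1 \<le> i" "i < k" "k < m" for i k
    using assms(3) that by simp
  \<comment> \<open>Since \<open>m >= 2\<close>, the index set is nonempty and \<open>Max\<close> is
    a genuine maximum.\<close>
  have max: "Max ((\<lambda>i. odd_greedy_bound x i m) ` {1..<m}) < of_int c \<longleftrightarrow>
      (\<forall>i\<in>{1..<m}. odd_greedy_bound x i m < of_int c)" for c :: int
    using assms(1) by (subst Max_less_iff) auto
  note least = odd_greater_iff_Least_odd[OF assms(4), unfolded ivl max]
  let ?S = "\<Sum>j\<in>{1..<m}. 1 / of_int (x j) :: rat"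
  \<comment> \<open>The first remainder is \<open>q\<close> itself, the subtracted sum being
    empty.\<close>
  have pos: "q > 0" if "odd_greedy_has_length q m" for q
  proof -
    have "odd_greedy_remainder q 1 > 0"
      using that assms(1) unfolding odd_greedy_has_length_def by simp
    then show ?thesis by (simp add: odd_greedy_remainder_def)
  qed
  have frac: "of_int (sigma (int m - 1) (map x [1..<m] @ [b])
                  + 2 * sigma (int m - 2) (map x [1..<m]) * int t) /
          of_int ((\<Prod>j\<in>{1..<m}. x j) * b + 2 * (\<Prod>j\<in>{1..<m}. x j) * int t) =
          ?S + 1 / of_int (b + 2 * int t)" for t
    \<comment> \<open>Read from right to left, \<open>least\<close> makes
      \<open>b + 2 * int t\<close> positive, hence nonzero.\<close>
    using least[of "b + 2 * int t"] assms(1) odd_pos by (intro sigma_fraction_eq) auto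
  have "q > 0 \<and> odd_greedy_has_length q m \<and> (\<forall>i\<in>{1..<m}. odd_greedy_denom q i = x i) \<longleftrightarrow>
      (\<exists>t::nat. q = ?S + 1 / of_int (b + 2 * int t))" for q
  proof -
    have "q > 0 \<and> odd_greedy_has_length q m \<and> (\<forall>i\<in>{1..<m}. odd_greedy_denom q i = x i) \<longleftrightarrow>
      (\<exists>c. (odd c \<and> c > 0 \<and> (\<forall>i\<in>{1..<m}. odd_greedy_bound x i m < of_int c)) \<and> q = ?S + 1 / of_int c)"
      using odd_greedy_expansion_iff[of m x q] odd_pos bounds assms(1) pos by auto
    then show ?thesis unfolding least by blast
  qed
  then show ?thesis unfolding ivl frac by auto
qed

end
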